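(* Let $n\ge1$, $k>\ell\ge1$ and $s\ge1$ be integers, let $d=\gcd(s,n)$, and let $C=\{0,s\}\subseteq\mathbb{Z}/n\mathbb{Z}$. Let $\delta=\gcd(n,k-\ell)$ and let $r\in\{0,\dots,\delta-1\}$ be the remainder of $-k\left\lfloor\frac{n+2(s-1)}{k+\ell}\right\rfloor+(s-1)$ modulo $\delta$. Then \[ \mu^{\{0,s\}}_{k,\ell}(\mathbb{Z}/n\mathbb{Z})\ \ge\ \max\left\{\max_{e\mid d}\left\{\mu_{k,\ell}(\mathbb{Z}/e\mathbb{Z})\cdot\frac{n}{e}\right\},\ \left\lfloor\frac{n+2(s-1)-r}{k+\ell}\right\rfloor-(s-1)\right\} \] and \[ \mu^{\{0,s\}}_{k,\ell}(\mathbb{Z}/n\mathbb{Z})\ \le\ \max\left\{\max_{e\mid d}\left\{\mu_{k,\ell}(\mathbb{Z}/e\mathbb{Z})\cdot\frac{n}{e}\right\},\ \left\lfloor\frac{n}{k+\ell}\right\rfloor\right\}, \] where the maxima over $e$ range over all positive divisors $e$ of $d$.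
   Context: For subsets $X,Y$ of an abelian group, $X+Y=\{x+y: x\in X, y\in Y\}$, and for an integer $j\ge 1$, $jX=X+\dots+X$ ($j$ copies); $0X=\{0\}$. A set $B$ in an abelian group $G$ is $(k,\ell)$-sum-free if $kB\cap \ell B=\emptyset$, and $\mu_{k,\ell}(G)$ is the maximum size of a $(k,\ell)$-sum-free subset of $G$ (so $\mu_{k,\ell}(\mathbb{Z}/1\mathbb{Z})=0$). For $A,C\subseteq \mathbb{Z}/n\mathbb{Z}$ and an integer $j\ge 1$, define $j *_C A = jA+(j-1)C$. A set $A\subseteq\mathbb{Z}/n\mathbb{Z}$ is $C$-$(k,\ell)$-sum-free if $(k *_C A)\cap(\ell *_C A)=\emptyset$. $\mu^C_{k,\ell}(\mathbb{Z}/n\mathbb{Z})$ denotes the maximum size of a $C$-$(k,\ell)$-sum-free subset of $\mathbb{Z}/n\mathbb{Z}$. *)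

theory Defs
  imports Main
begin

text \<open>Z/nZ is modelled by the residues {0..<n} (natural numbers) with addition mod n.\<close>

definition set_add_mod :: "nat \<Rightarrow> nat set \<Rightarrow> nat set \<Rightarrow> nat set" where
  "set_add_mod n X Y = {(x + y) mod n | x y. x \<in> X \<and> y \<in> Y}"

fun iter_sum :: "nat \<Rightarrow> nat \<Rightarrow> nat set \<Rightarrow> nat set" where
  "iter_sum n 0 X = {0}"
| "iter_sum n (Suc j) X = set_add_mod n X (iter_sum n j X)"

definition kl_sum_free :: "nat \<Rightarrow> nat \<Rightarrow> nat \<Rightarrow> nat set \<Rightarrow> bool" where
  "kl_sum_free n k l B \<longleftrightarrow> B \<subseteq> {0..<n} \<and> iter_sum n k B \<inter> iter_sum n l B = {}"

definition mu :: "nat \<Rightarrow> nat \<Rightarrow> nat \<Rightarrow> nat" where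
  "mu n k l = Max {card B | B. kl_sum_free n k l B}"

definition cstar :: "nat \<Rightarrow> nat set \<Rightarrow> nat \<Rightarrow> nat set \<Rightarrow> nat set" where
  "cstar n C j A = set_add_mod n (iter_sum n j A) (iter_sum n (j - 1) C)"

definition C_kl_sum_free :: "nat \<Rightarrow> nat set \<Rightarrow> nat \<Rightarrow> nat \<Rightarrow> nat set \<Rightarrow> bool" where
  "C_kl_sum_free n C k l A \<longleftrightarrow> A \<subseteq> {0..<n} \<and> cstar n C k A \<inter> cstar n C l A = {}"

definition muC :: "nat \<Rightarrow> nat set \<Rightarrow> nat \<Rightarrow> nat \<Rightarrow> nat" where
  "muC n C k l = Max {card A | A. C_kl_sum_free n C k l A}"

end

theory Submission
  imports Defs "HOL-Library.Set_Algebras" "HOL-Number_Theory.Cong"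
begin

text \<open>Let \<open>A\<close> be \<open>{0, s}\<close>-sum-free and suppose that its image modulo \<open>d = gcd s n\<close> is not sum-free.
  Then there are \<open>a\<^sub>i\<close> and \<open>b\<^sub>j\<close> in \<open>A\<close> whose sums differ by a multiple of \<open>d\<close>, so that the
  sumset of the \<open>k + l\<close> sets \<open>A - a\<^sub>i\<close>, \<open>b\<^sub>j - A\<close> and the progression
  \<open>{0, s, \<dots>, (k + l - 2) s}\<close> misses some multiple of \<open>s\<close>, although each set contains zero.
  Dyson transforms that keep zero in every set reduce to the case in which all but one set lie in the
  stabilizer \<open>H\<close> of the remaining one, \<open>P\<close>. Adding \<open>{0, s}\<close> to \<open>P\<close> then adds at least one coset of
  \<open>H\<close> each time, and a coset is still missing at the end; counting gives \<open>(k + l) |A| \<le> n\<close>. No form of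
  Kneser's theorem is needed.

  If the image \<open>B\<close> of \<open>A\<close> modulo \<open>d\<close> is sum-free, then \<open>A\<close> lies in the preimage of \<open>B\<close>. For the lower
  bound one takes such preimages for every divisor of \<open>d\<close>, and an interval \<open>{a, \<dots>, a + t - 1}\<close> whose
  start is chosen through the residue \<open>(k - l) a\<close>, which runs over all multiples of \<open>gcd n (k - l)\<close>.\<close>

section \<open>Sums of subsets of the integers that are periodic modulo n\<close>

text \<open>Subsets of Z/nZ are represented by their full preimages in the integers, so that the
  sumset operation on \<open>int set\<close> and \<open>sum_list\<close> apply without reductions;
  \<open>residue_count\<close> then plays the role of the cardinality in Z/nZ.\<close>

definition periodic :: "int \<Rightarrow> int set \<Rightarrow> bool" where
  "periodic n A \<longleftrightarrow> (\<forall>x\<in>A. \<forall>k. x + k * n \<in> A)"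

definition residue_count :: "int \<Rightarrow> int set \<Rightarrow> nat" where
  "residue_count n A = card (A \<inter> {0..<n})"

lemma periodic_cong:
  assumes "periodic n A" "[x = y] (mod n)"
  shows "x \<in> A \<longleftrightarrow> y \<in> A"
proof -
  obtain k where k: "y = x + k * n"
    using assms(2) by (auto simp: cong_iff_lin mult.commute)
  have shift: "z \<in> A \<Longrightarrow> z + j * n \<in> A" for z j
    using assms(1) by (simp add: periodic_def)
  from shift[of x k] shift[of y "- k"] k show ?thesis by auto
qed

lemma periodic_mod_mem: "periodic n A \<Longrightarrow> x mod n \<in> A \<longleftrightarrow> x \<in> A"
  by (rule periodic_cong) (assumption, simp only: cong_def mod_mod_trivial)

lemma periodicI:
  assumes "\<And>x y. [x = y] (mod n) \<Longrightarrow> x \<in> A \<Longrightarrow> y \<in> A"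
  shows "periodic n A"
  unfolding periodic_def
proof (intro ballI allI)
  fix x k assume "x \<in> A"
  show "x + k * n \<in> A" by (rule assms[OF _ \<open>x \<in> A\<close>]) (simp add: cong_def)
qed

lemma periodic_translate:
  assumes "periodic n A"
  shows "periodic n {x. x + e \<in> A}"
proof (rule periodicI)
  fix x y assume "[x = y] (mod n)" and x: "x \<in> {x. x + e \<in> A}"
  then have "[x + e = y + e] (mod n)" by (intro cong_add) auto
  with x show "y \<in> {x. x + e \<in> A}" using periodic_cong[OF assms] by auto
qed

lemma periodic_reflect:
  assumes "periodic n A"
  shows "periodic n {x. e - x \<in> A}"
proof (rule periodicI)
  fix x y assume "[x = y] (mod n)" and x: "x \<in> {x. e - x \<in> A}"
  then have "[e - x = e - y] (mod n)" by (intro cong_diff) auto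
  with x show "y \<in> {x. e - x \<in> A}" using periodic_cong[OF assms] by auto
qed

lemma periodic_Un: "periodic n A \<Longrightarrow> periodic n B \<Longrightarrow> periodic n (A \<union> B)"
  by (simp add: periodic_def ball_Un)

lemma periodic_Int: "periodic n A \<Longrightarrow> periodic n B \<Longrightarrow> periodic n (A \<inter> B)"
  by (simp add: periodic_def)

lemma residue_count_mono: "A \<subseteq> B \<Longrightarrow> residue_count n A \<le> residue_count n B"
  unfolding residue_count_def by (intro card_mono) auto

lemma residue_count_UNIV: "residue_count n UNIV = nat n"
  unfolding residue_count_def by simp

lemma residue_count_le: "residue_count n A \<le> nat n"
  using residue_count_mono[of A UNIV n] by (simp add: residue_count_UNIV)

lemma residue_count_Un_Int:
  "residue_count n (A \<union> B) + residue_count n (A \<inter> B) = residue_count n A + residue_count n B"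
proof -
  have "(A \<union> B) \<inter> {0..<n} = (A \<inter> {0..<n}) \<union> (B \<inter> {0..<n})"
       "(A \<inter> B) \<inter> {0..<n} = (A \<inter> {0..<n}) \<inter> (B \<inter> {0..<n})" by auto
  then show ?thesis unfolding residue_count_def
    using card_Un_Int[of "A \<inter> {0..<n}" "B \<inter> {0..<n}"] by simp
qed

lemma residue_count_less:
  assumes "0 < n" "periodic n A" "periodic n B" "A \<subseteq> B" "x \<in> B" "x \<notin> A"
  shows "residue_count n A < residue_count n B"
proof -
  have "x mod n \<in> B" "x mod n \<notin> A" "x mod n \<in> {0..<n}"
    using assms by (simp_all add: periodic_mod_mem)
  then have "A \<inter> {0..<n} \<subset> B \<inter> {0..<n}" using assms(4) by blast
  then show ?thesis unfolding residue_count_def by (intro psubset_card_mono) auto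
qed

text \<open>A left inverse \<open>g\<close> modulo n makes \<open>f\<close> injective on residues.
  Translations and reflections use this twice, once for \<open>A\<close> and once for its image, to
  turn the inequality into an equality.\<close>

lemma residue_count_le_involution:
  assumes n: "0 < n" and A: "periodic n A"
    and f: "\<And>x. [g (f x) = x] (mod n)" and g: "\<And>x y. [x = y] (mod n) \<Longrightarrow> [g x = g y] (mod n)"
  shows "residue_count n {x. f x \<in> A} \<le> residue_count n A"
  unfolding residue_count_def
proof (rule card_inj_on_le[of "\<lambda>x. f x mod n"])
  show "inj_on (\<lambda>x. f x mod n) ({x. f x \<in> A} \<inter> {0..<n})"
  proof (rule inj_onI)
    fix x y assume *: "x \<in> {x. f x \<in> A} \<inter> {0..<n}" "y \<in> {x. f x \<in> A} \<inter> {0..<n}"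
      and "f x mod n = f y mod n"
    then have "[g (f x) = g (f y)] (mod n)" by (intro g) (simp add: cong_def)
    then have "[x = y] (mod n)" using f by (metis cong_sym cong_trans)
    with * show "x = y" by (simp add: cong_def)
  qed
  show "(\<lambda>x. f x mod n) ` ({x. f x \<in> A} \<inter> {0..<n}) \<subseteq> A \<inter> {0..<n}"
    using n by (auto simp: periodic_mod_mem[OF A])
qed auto

lemma residue_count_translate:
  assumes "0 < n" "periodic n A"
  shows "residue_count n {x. x + e \<in> A} = residue_count n A"
proof (rule antisym)
  show "residue_count n {x. x + e \<in> A} \<le> residue_count n A"
    using assms by (intro residue_count_le_involution[where g = "\<lambda>x. x - e"]) (auto intro: cong_diff)
  have "residue_count n {x. x + (-e) \<in> {x. x + e \<in> A}} \<le> residue_count n {x. x + e \<in> A}"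
    using assms by (intro residue_count_le_involution[where g = "\<lambda>x. x + e"] periodic_translate)
      (auto intro: cong_add)
  then show "residue_count n A \<le> residue_count n {x. x + e \<in> A}" by simp
qed

lemma residue_count_reflect:
  assumes "0 < n" "periodic n A"
  shows "residue_count n {x. e - x \<in> A} = residue_count n A"
proof (rule antisym)
  show "residue_count n {x. e - x \<in> A} \<le> residue_count n A"
    using assms by (intro residue_count_le_involution[where g = "\<lambda>x. e - x"]) (auto intro: cong_diff)
  have "residue_count n {x. e - x \<in> {x. e - x \<in> A}} \<le> residue_count n {x. e - x \<in> A}"
    using assms by (intro residue_count_le_involution[where g = "\<lambda>x. e - x"] periodic_reflect)
      (auto intro: cong_diff)
  then show "residue_count n A \<le> residue_count n {x. e - x \<in> A}" by simp
qed

section \<open>Stabilizers and growth by cosets\<close>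

definition stabilizer :: "int set \<Rightarrow> int set" where
  "stabilizer A = {h. \<forall>x\<in>A. x + h \<in> A}"

text \<open>Iterating a shift inverts it: \<open>(n - 1) * h\<close> is congruent to
  \<open>- h\<close> modulo \<open>n\<close>. Hence the one-sided inclusion in the definition
  already yields a group.\<close>

lemma stabilizer_uminus:
  assumes "0 < n" "periodic n A" "h \<in> stabilizer A"
  shows "- h \<in> stabilizer A"
proof -
  have mult: "x + int i * h \<in> A" if "x \<in> A" for x i
    using that assms(3) by (induction i) (auto simp: stabilizer_def algebra_simps)
  have "x - h \<in> A" if "x \<in> A" for x
  proof -
    have "(x + int (nat (n - 1)) * h) + (- h) * n \<in> A"
      using assms(2) mult[OF that, of "nat (n - 1)"] unfolding periodic_def by blast
    then show ?thesis using assms(1) by (simp add: algebra_simps)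
  qed
  then show ?thesis by (simp add: stabilizer_def)
qed

lemma periodic_stabilizer:
  assumes "periodic n A"
  shows "periodic n (stabilizer A)"
proof (rule periodicI)
  fix x y assume xy: "[x = y] (mod n)" "x \<in> stabilizer A"
  have "[z + x = z + y] (mod n)" for z using xy(1) by (intro cong_add) auto
  then show "y \<in> stabilizer A"
    using xy(2) periodic_cong[OF assms] unfolding stabilizer_def by blast
qed

text \<open>Both \<open>U\<close> and \<open>V\<close> are unions of cosets of \<open>H\<close>, so
  the whole coset of \<open>x\<close> lies in \<open>V\<close> and avoids \<open>U\<close>.\<close>

lemma residue_count_coset_gap:
  assumes n: "0 < n" and H: "periodic n H" "\<And>h. h \<in> H \<Longrightarrow> - h \<in> H"
    and U: "\<And>h x. h \<in> H \<Longrightarrow> x \<in> U \<Longrightarrow> x + h \<in> U"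
    and V: "\<And>h x. h \<in> H \<Longrightarrow> x \<in> V \<Longrightarrow> x + h \<in> V"
    and "U \<subseteq> V" "x \<in> V" "x \<notin> U"
  shows "residue_count n U + residue_count n H \<le> residue_count n V"
proof -
  let ?K = "{y. y + (- x) \<in> H}"
  have K: "residue_count n ?K = residue_count n H"
    using n H(1) by (rule residue_count_translate)
  have "?K \<subseteq> V"
  proof
    fix y assume "y \<in> ?K"
    then have "x + (y - x) \<in> V" using V[of "y - x" x] assms(7) by auto
    then show "y \<in> V" by simp
  qed
  moreover have "?K \<inter> U = {}"
  proof (rule ccontr)
    assume "?K \<inter> U \<noteq> {}"
    then obtain y where y: "y + (- x) \<in> H" "y \<in> U" by auto
    from U[OF H(2)[OF y(1)] y(2)] have "x \<in> U" by simp
    with assms(8) show False ..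
  qed
  ultimately have "residue_count n U + residue_count n ?K = residue_count n (U \<union> ?K)"
    using residue_count_Un_Int[of n U ?K] by (simp add: Int_commute residue_count_def)
  also have "\<dots> \<le> residue_count n V" using \<open>?K \<subseteq> V\<close> assms(6) by (intro residue_count_mono) auto
  finally show ?thesis by (simp only: K)
qed

text \<open>Put \<open>T j\<close> for the sum of \<open>P\<close> and the multiples of
  \<open>s\<close> from 0 to \<open>j * s\<close>; it is a union of cosets of the stabilizer. If
  \<open>T (Suc j)\<close> were no larger than \<open>T j\<close>, then \<open>T j\<close> would be
  closed under adding \<open>s\<close> and contain every nonnegative multiple of \<open>s\<close>,
  against the choice of \<open>c\<close>. So each step gains a coset.\<close>

lemma stabilizer_progression_bound:
  assumes n: "0 < n" and P: "periodic n P" "0 \<in> P"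
    and c: "int c * s \<notin> P + (\<lambda>i. int i * s) ` {..<m}"
  shows "residue_count n P + m * residue_count n (stabilizer P) \<le> nat n"
proof (cases m)
  case 0
  then show ?thesis using residue_count_le by simp
next
  case (Suc m')
  define H where "H = stabilizer P"
  define T where "T j = P + (\<lambda>i. int i * s) ` {..j}" for j :: nat
  have memT: "x \<in> T j \<longleftrightarrow> (\<exists>p\<in>P. \<exists>i\<le>j. x = p + int i * s)" for x j
    unfolding T_def set_plus_def by auto
  have TI: "p + int i * s \<in> T j" if "p \<in> P" "i \<le> j" for p i j
    using that memT by auto
  have TE: "\<exists>p i. p \<in> P \<and> i \<le> j \<and> x = p + int i * s" if "x \<in> T j" for x j
    using that memT by auto
  have H: "periodic n H" "h \<in> H \<Longrightarrow> - h \<in> H" for h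
    unfolding H_def using n P periodic_stabilizer stabilizer_uminus by auto
  have TH: "x + h \<in> T j" if h: "h \<in> H" and x: "x \<in> T j" for h x j
  proof -
    obtain p i where p: "p \<in> P" "i \<le> j" "x = p + int i * s" using TE[OF x] by auto
    then have "p + h \<in> P" using h by (auto simp: H_def stabilizer_def)
    from TI[OF this p(2)] show ?thesis by (simp add: p(3) algebra_simps)
  qed
  have mono: "T j \<subseteq> T j'" if "j \<le> j'" for j j'
    using that TI by (auto dest!: TE)
  have cT: "int c * s \<notin> T j" if "j \<le> m'" for j
    using c Suc that mono[of j m'] by (auto simp: T_def lessThan_Suc_atMost)
  have step: "\<exists>x \<in> T (Suc j). x \<notin> T j" if "j \<le> m'" for j
  proof (rule ccontr)
    assume "\<not> ?thesis"
    then have *: "x \<in> T j" if "x \<in> T (Suc j)" for x using that by blast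
    have add_s: "x + s \<in> T j" if x: "x \<in> T j" for x
    proof -
      obtain p i where p: "p \<in> P" "i \<le> j" "x = p + int i * s" using TE[OF x] by auto
      then have "p + int (Suc i) * s \<in> T (Suc j)" by (intro TI) auto
      then show ?thesis by (intro *) (simp add: p(3) algebra_simps)
    qed
    have "int i * s \<in> T j" for i
    proof (induction i)
      case 0
      show ?case using TI[OF P(2), of 0 j] by simp
    next
      case (Suc i)
      from add_s[OF this] show ?case by (simp add: algebra_simps)
    qed
    with cT[OF that] show False by blast
  qed
  have grow: "residue_count n P + j * residue_count n H \<le> residue_count n (T j)" if "j \<le> m'" for j
    using that
  proof (induction j)
    case 0
    have "T 0 = P" by (auto simp: T_def set_plus_def)
    then show ?case by simp
  next
    case (Suc j)
    obtain x where x: "x \<in> T (Suc j)" "x \<notin> T j" using step[of j] Suc.prems by auto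
    have sub: "T j \<subseteq> T (Suc j)" by (rule mono) simp
    have "residue_count n (T j) + residue_count n H \<le> residue_count n (T (Suc j))"
      by (rule residue_count_coset_gap[where x = x]) (fact n H TH sub x)+
    then show ?case using Suc by simp
  qed
  \<comment> \<open>The steps up to \<open>m' = m - 1\<close> give \<open>m - 1\<close> cosets; the
    one through \<open>int c * s\<close>, still missing from \<open>T m'\<close>, is the last of the
    \<open>m\<close>.\<close>
  have "residue_count n (T m') + residue_count n H \<le> residue_count n UNIV"
    by (rule residue_count_coset_gap[where x = "int c * s"])
      (fact n H TH | simp add: cT)+
  then show ?thesis using grow[of m'] Suc by (simp add: residue_count_UNIV H_def)
qed

section \<open>Dyson transforms of a family of sets\<close>

lemma zero_in_sum_list:
  fixes L :: "int set list"
  shows "\<forall>A\<in>set L. 0 \<in> A \<Longrightarrow> 0 \<in> sum_list L"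
proof (induction L)
  case (Cons A L)
  then have "0 + 0 \<in> A + sum_list L" by (intro set_plus_intro) auto
  then show ?case by simp
qed simp

text \<open>An element of \<open>A\<close> shifted by \<open>e\<close> is only ever added to some
  \<open>y\<close> with \<open>y + e\<close> in \<open>P\<close>, and moving the shift from one
  summand to the other gives a sum from \<open>P\<close> and \<open>A\<close>. The set
  \<open>Q\<close> collects the remaining summands.\<close>

lemma Dyson_transform_subset:
  fixes A P Q :: "int set"
  shows "(P \<union> {x. x - e \<in> A}) + (A \<inter> {x. x + e \<in> P}) + Q \<subseteq> P + A + Q"
proof (rule set_plus_mono2[OF subsetI order_refl])
  fix z assume "z \<in> (P \<union> {x. x - e \<in> A}) + (A \<inter> {x. x + e \<in> P})"
  then obtain x y where z: "z = x + y" and x: "x \<in> P \<or> x - e \<in> A" and y: "y \<in> A" "y + e \<in> P"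
    by (auto elim!: set_plus_elim)
  show "z \<in> P + A"
  proof (cases "x \<in> P")
    case True
    then show ?thesis using y z by (auto intro: set_plus_intro)
  next
    case False
    with x have "x - e \<in> A" by simp
    with y(2) have "(y + e) + (x - e) \<in> P + A" by (intro set_plus_intro)
    then show ?thesis by (simp add: z add.commute)
  qed
qed

text \<open>Only shifts \<open>e \<in> P\<close> are used in the Dyson transform, so that zero stays in every set.
  When no shift enlarges \<open>P\<close>, every set of \<open>L\<close> lies in the stabilizer of \<open>P\<close>.\<close>

lemma sumset_progression_bound:
  assumes n: "0 < n" and "periodic n P" "0 \<in> P"
    and "\<forall>A\<in>set L. periodic n A \<and> 0 \<in> A"
    and "int c * s \<notin> P + sum_list L + (\<lambda>i. int i * s) ` {..<length L}"
  shows "residue_count n P + (\<Sum>A\<leftarrow>L. residue_count n A) \<le> nat n"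
  using assms(2-)
\<comment> \<open>Each transform that is carried out strictly enlarges \<open>P\<close>, whose count
  never exceeds \<open>n\<close>.\<close>
proof (induction "nat n - residue_count n P" arbitrary: P L rule: less_induct)
  case less
  define S where "S = (\<lambda>i. int i * s) ` {..<length L}"
  show ?case
  proof (cases "\<exists>A\<in>set L. \<exists>e\<in>P. \<exists>a\<in>A. e + a \<notin> P")
    case True
    then obtain A e a where A: "A \<in> set L" "e \<in> P" "a \<in> A" "e + a \<notin> P" by blast
    then obtain xs ys where L: "L = xs @ A # ys" by (meson split_list)
    define P' where "P' = P \<union> {x. x - e \<in> A}"
    define A' where "A' = A \<inter> {x. x + e \<in> P}"
    define L' where "L' = xs @ A' # ys"
    have perA: "periodic n A" "0 \<in> A" using less.prems A by auto
    have P': "periodic n P'" "0 \<in> P'"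
      unfolding P'_def using less.prems perA periodic_translate[of n A "- e"] by (auto intro!: periodic_Un)
    have A': "periodic n A'" "0 \<in> A'"
      unfolding A'_def using less.prems perA A by (auto intro!: periodic_Int periodic_translate)
    have L': "\<forall>A\<in>set L'. periodic n A \<and> 0 \<in> A"
      using less.prems L A' by (auto simp: L'_def)
    have "P' + A' + (sum_list xs + sum_list ys + S) \<subseteq> P + A + (sum_list xs + sum_list ys + S)"
      unfolding P'_def A'_def by (rule Dyson_transform_subset)
    then have "P' + sum_list L' + S \<subseteq> P + sum_list L + S"
      by (simp add: L L'_def ac_simps)
    with less.prems(4) have notin: "int c * s \<notin> P' + sum_list L' + (\<lambda>i. int i * s) ` {..<length L'}"
      by (auto simp: S_def L L'_def)
    have "residue_count n P < residue_count n P'"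
      using A n P' less.prems(1)
      by (intro residue_count_less[of n P P' "e + a"]) (auto simp: P'_def)
    then have "nat n - residue_count n P' < nat n - residue_count n P"
      using residue_count_le[of n P'] by linarith
    from less.hyps[OF this P' L' notin]
    have IH: "residue_count n P' + (\<Sum>A\<leftarrow>L'. residue_count n A) \<le> nat n" .
    \<comment> \<open>Shifted by \<open>e\<close>, the set \<open>A'\<close> becomes the
      intersection of \<open>P\<close> with the shift of \<open>A\<close>, while \<open>P'\<close>
      is their union; so the transform preserves the total count.\<close>
    have A'_eq: "residue_count n A' = residue_count n (P \<inter> {x. x - e \<in> A})"
    proof -
      have "A' = {x. x + e \<in> P \<inter> {x. x - e \<in> A}}" by (auto simp: A'_def)
      then show ?thesis
        using residue_count_translate[OF n, of "P \<inter> {x. x - e \<in> A}" e] less.prems(1) perA(1)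
          periodic_translate[of n A "- e"]
        by (simp add: periodic_Int)
    qed
    have "residue_count n P' + residue_count n A' = residue_count n P + residue_count n A"
      using residue_count_Un_Int[of n P "{x. x - e \<in> A}"]
        residue_count_translate[OF n perA(1), of "- e"] by (simp add: A'_eq P'_def)
    with IH show ?thesis by (simp add: L L'_def)
  next
    case False
    have sub: "A \<subseteq> stabilizer P" if "A \<in> set L" for A
      using False that by (auto simp: stabilizer_def)
    \<comment> \<open>Since zero lies in every set of \<open>L\<close>, dropping these sets from the
      sum can only shrink it, and the missing multiple of \<open>s\<close> stays missing.\<close>
    have "P + S \<subseteq> P + sum_list L + S"
    proof (intro set_plus_mono2 order_refl)
      have "P \<subseteq> sum_list L + P"
        using less.prems(3) by (intro set_zero_plus2 zero_in_sum_list) auto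
      then show "P \<subseteq> P + sum_list L" by (simp only: add.commute)
    qed
    with less.prems(4) have "int c * s \<notin> P + (\<lambda>i. int i * s) ` {..<length L}"
      by (auto simp: S_def)
    from stabilizer_progression_bound[OF n less.prems(1,2) this]
    have "residue_count n P + length L * residue_count n (stabilizer P) \<le> nat n" .
    moreover have "(\<Sum>A\<leftarrow>L. residue_count n A) \<le> (\<Sum>A\<leftarrow>L. residue_count n (stabilizer P))"
      by (intro sum_list_mono residue_count_mono sub)
    ultimately show ?thesis unfolding sum_list_triv by simp
  qed
qed

section \<open>Sum-free sets of residues\<close>

lemma mem_iter_sum:
  "z \<in> iter_sum n j X \<longleftrightarrow> (\<exists>xs. length xs = j \<and> set xs \<subseteq> X \<and> z = sum_list xs mod n)"
proof (induction j arbitrary: z)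
  case 0
  then show ?case by simp
next
  case (Suc j)
  show ?case
  proof
    assume "z \<in> iter_sum n (Suc j) X"
    then obtain x xs where x: "x \<in> X" "length xs = j" "set xs \<subseteq> X"
      and z: "z = (x + sum_list xs mod n) mod n"
      using Suc.IH by (auto simp: set_add_mod_def)
    show "\<exists>xs. length xs = Suc j \<and> set xs \<subseteq> X \<and> z = sum_list xs mod n"
      using x z by (intro exI[of _ "x # xs"]) (simp add: mod_add_right_eq)
  next
    assume "\<exists>xs. length xs = Suc j \<and> set xs \<subseteq> X \<and> z = sum_list xs mod n"
    then obtain x xs where x: "x \<in> X" "length xs = j" "set xs \<subseteq> X"
      and z: "z = (x + sum_list xs) mod n"
      by (auto simp: length_Suc_conv)
    have "sum_list xs mod n \<in> iter_sum n j X" using Suc.IH x by blast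
    moreover have "z = (x + sum_list xs mod n) mod n" using z by (simp add: mod_add_right_eq)
    ultimately show "z \<in> iter_sum n (Suc j) X" using x(1) by (auto simp: set_add_mod_def)
  qed
qed

lemma mem_iter_sum_pair:
  "z \<in> iter_sum n j {0, s mod n} \<longleftrightarrow> (\<exists>c\<le>j. z = c * s mod n)"
proof (induction j arbitrary: z)
  case 0
  then show ?case by simp
next
  case (Suc j)
  show ?case
  proof
    assume "z \<in> iter_sum n (Suc j) {0, s mod n}"
    then obtain x c where x: "x = 0 \<or> x = s mod n" "c \<le> j"
      and z: "z = (x + c * s mod n) mod n"
      using Suc.IH by (auto simp: set_add_mod_def)
    show "\<exists>c\<le>Suc j. z = c * s mod n"
    proof (cases "x = 0")
      case True
      then show ?thesis using x z by (intro exI[of _ c]) simp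
    next
      case False
      then have "z = Suc c * s mod n" using x z by (simp add: mod_add_eq)
      then show ?thesis using x by (intro exI[of _ "Suc c"]) simp
    qed
  next
    assume "\<exists>c\<le>Suc j. z = c * s mod n"
    then obtain c where c: "c \<le> Suc j" "z = c * s mod n" by blast
    have "\<exists>x c'. (x = 0 \<or> x = s mod n) \<and> c' \<le> j \<and> z = (x + c' * s mod n) mod n"
    proof (cases c)
      case 0
      then show ?thesis using c by (intro exI[of _ 0]) simp
    next
      case (Suc c')
      then show ?thesis using c
        by (intro exI[of _ "s mod n"] exI[of _ c']) (simp add: mod_add_eq)
    qed
    then obtain x c' where x: "x \<in> {0, s mod n}" and c': "c' \<le> j"
      and z: "z = (x + c' * s mod n) mod n" by auto
    have "c' * s mod n \<in> iter_sum n j {0, s mod n}" using Suc.IH c' by blast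
    then show "z \<in> iter_sum n (Suc j) {0, s mod n}"
      unfolding iter_sum.simps set_add_mod_def using x z by blast
  qed
qed

lemma mem_cstar_pair:
  assumes "1 \<le> j"
  shows "z \<in> cstar n {0, s mod n} j A \<longleftrightarrow>
    (\<exists>xs u. length xs = j \<and> set xs \<subseteq> A \<and> u < j \<and> z = (sum_list xs + u * s) mod n)"
proof -
  have "z \<in> cstar n {0, s mod n} j A \<longleftrightarrow>
    (\<exists>xs u. length xs = j \<and> set xs \<subseteq> A \<and> u \<le> j - 1 \<and>
      z = (sum_list xs mod n + u * s mod n) mod n)"
    unfolding cstar_def set_add_mod_def mem_Collect_eq mem_iter_sum_pair
    unfolding mem_iter_sum by blast
  moreover have "u \<le> j - 1 \<longleftrightarrow> u < j" for u using assms by linarith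
  ultimately show ?thesis by (simp add: mod_add_eq)
qed

lemma kl_sum_free_iff:
  "kl_sum_free n k l B \<longleftrightarrow> B \<subseteq> {0..<n} \<and>
    (\<forall>xs ys. length xs = k \<longrightarrow> set xs \<subseteq> B \<longrightarrow> length ys = l \<longrightarrow> set ys \<subseteq> B \<longrightarrow>
      \<not> [sum_list xs = sum_list ys] (mod n))"
  unfolding kl_sum_free_def disjoint_iff mem_iter_sum cong_def by metis

lemma C_kl_sum_free_iff:
  assumes "1 \<le> k" "1 \<le> l"
  shows "C_kl_sum_free n {0, s mod n} k l A \<longleftrightarrow> A \<subseteq> {0..<n} \<and>
    (\<forall>xs ys u v. length xs = k \<longrightarrow> set xs \<subseteq> A \<longrightarrow> length ys = l \<longrightarrow> set ys \<subseteq> A \<longrightarrow>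
      u < k \<longrightarrow> v < l \<longrightarrow> \<not> [sum_list xs + u * s = sum_list ys + v * s] (mod n))"
  unfolding C_kl_sum_free_def disjoint_iff mem_cstar_pair[OF assms(1)] mem_cstar_pair[OF assms(2)]
    cong_def by metis

lemma finite_card_subsets:
  assumes "\<And>B. P B \<Longrightarrow> B \<subseteq> {0..<n::nat}"
  shows "finite {card B | B. P B}"
proof -
  have "{B. P B} \<subseteq> Pow {0..<n}" using assms by auto
  then have "finite {B. P B}" by (rule finite_subset) simp
  then show ?thesis by simp
qed

lemma card_le_mu: "kl_sum_free n k l B \<Longrightarrow> card B \<le> mu n k l"
  unfolding mu_def by (intro Max_ge finite_card_subsets[of _ n]) (auto simp: kl_sum_free_def)

lemma mu_attained:
  assumes "1 \<le> k"
  obtains B where "kl_sum_free n k l B" "card B = mu n k l"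
proof -
  \<comment> \<open>No list of positive length has its entries in the empty set, so the maximum is
    taken over a nonempty set.\<close>
  have "kl_sum_free n k l {}" using assms by (auto simp: kl_sum_free_iff)
  then have "mu n k l \<in> {card B | B. kl_sum_free n k l B}"
    unfolding mu_def by (intro Max_in finite_card_subsets[of _ n]) (auto simp: kl_sum_free_def)
  then show ?thesis using that by auto
qed

lemma card_le_muC: "C_kl_sum_free n C k l A \<Longrightarrow> card A \<le> muC n C k l"
  unfolding muC_def by (intro Max_ge finite_card_subsets[of _ n]) (auto simp: C_kl_sum_free_def)

lemma muC_attained:
  assumes "1 \<le> k" "1 \<le> l"
  obtains A where "C_kl_sum_free n {0, s mod n} k l A" "card A = muC n {0, s mod n} k l"
proof -
  have "C_kl_sum_free n {0, s mod n} k l {}" using assms by (auto simp: C_kl_sum_free_iff)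
  then have "muC n {0, s mod n} k l \<in> {card A | A. C_kl_sum_free n {0, s mod n} k l A}"
    unfolding muC_def by (intro Max_in finite_card_subsets[of _ n]) (auto simp: C_kl_sum_free_def)
  then show ?thesis using that by auto
qed

section \<open>Preimages of sum-free sets modulo a divisor\<close>

lemma card_residue_preimage:
  fixes e n :: nat
  assumes "0 < e" "e dvd n" "B \<subseteq> {0..<e}"
  shows "card {x \<in> {0..<n}. x mod e \<in> B} = card B * (n div e)"
proof -
  obtain q where n: "n = e * q" using assms(2) by (auto elim: dvdE)
  have "bij_betw (\<lambda>(b, i). b + e * i) (B \<times> {0..<q}) {x \<in> {0..<n}. x mod e \<in> B}"
  proof (rule bij_betw_byWitness[where f' = "\<lambda>x. (x mod e, x div e)"])
    show "\<forall>p\<in>B \<times> {0..<q}. (\<lambda>x. (x mod e, x div e)) ((\<lambda>(b, i). b + e * i) p) = p"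
      using assms(1,3) by (auto simp: subset_iff)
    show "\<forall>x\<in>{x \<in> {0..<n}. x mod e \<in> B}. (\<lambda>(b, i). b + e * i) (x mod e, x div e) = x"
      by simp
    show "(\<lambda>(b, i). b + e * i) ` (B \<times> {0..<q}) \<subseteq> {x \<in> {0..<n}. x mod e \<in> B}"
    proof (rule image_subsetI)
      fix p assume "p \<in> B \<times> {0..<q}"
      then obtain b i where p: "p = (b, i)" "b \<in> B" "i < q" by auto
      then have "b < e" "Suc i \<le> q" using assms(3) by auto
      then have "b + e * i < e * Suc i" by simp
      also have "\<dots> \<le> n" unfolding n using \<open>Suc i \<le> q\<close> by (rule mult_le_mono2)
      finally have "b + e * i < n" .
      then show "(\<lambda>(b, i). b + e * i) p \<in> {x \<in> {0..<n}. x mod e \<in> B}"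
        using p \<open>b < e\<close> by simp
    qed
    show "(\<lambda>x. (x mod e, x div e)) ` {x \<in> {0..<n}. x mod e \<in> B} \<subseteq> B \<times> {0..<q}"
      using assms(1) by (auto simp: n less_mult_imp_div_less mult.commute)
  qed
  then have "card (B \<times> {0..<q}) = card {x \<in> {0..<n}. x mod e \<in> B}" by (rule bij_betw_same_card)
  then have "card {x \<in> {0..<n}. x mod e \<in> B} = card B * q" by (simp only: card_cartesian_product) simp
  then show ?thesis using assms(1) by (simp add: n)
qed

lemma cong_sum_list_map_mod:
  fixes xs :: "nat list"
  shows "[sum_list (map (\<lambda>x. x mod e) xs) = sum_list xs] (mod e)"
  by (induction xs) (simp_all add: cong_add)

text \<open>Modulo \<open>e\<close> the multiples of \<open>s\<close> vanish, so a forbidden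
  relation modulo \<open>n\<close> descends to a plain relation between sums in
  \<open>B\<close>.\<close>

lemma C_kl_sum_free_residue_preimage:
  assumes kl: "1 \<le> k" "1 \<le> l" and e: "e dvd n" "e dvd s" and B: "kl_sum_free e k l B"
  shows "C_kl_sum_free n {0, s mod n} k l {x \<in> {0..<n}. x mod e \<in> B}"
  unfolding C_kl_sum_free_iff[OF kl]
proof (intro conjI allI impI notI)
  show "{x \<in> {0..<n}. x mod e \<in> B} \<subseteq> {0..<n}" by auto
  fix xs ys u v
  assume xs: "length xs = k" "set xs \<subseteq> {x \<in> {0..<n}. x mod e \<in> B}"
    and ys: "length ys = l" "set ys \<subseteq> {x \<in> {0..<n}. x mod e \<in> B}"
    and "[sum_list xs + u * s = sum_list ys + v * s] (mod n)"
  then have eq: "[sum_list xs + u * s = sum_list ys + v * s] (mod e)"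
    using e(1) cong_dvd_modulus_nat by blast
  have drop: "[z + w * s = z] (mod e)" for z w
    using cong_add[of z z e "w * s" 0] e(2) by (simp add: cong_0_iff)
  have "[sum_list xs = sum_list ys] (mod e)"
    using eq drop by (metis cong_sym cong_trans)
  then have "[sum_list (map (\<lambda>x. x mod e) xs) = sum_list (map (\<lambda>x. x mod e) ys)] (mod e)"
    using cong_sum_list_map_mod by (metis cong_sym cong_trans)
  moreover have "set (map (\<lambda>x. x mod e) xs) \<subseteq> B" "set (map (\<lambda>x. x mod e) ys) \<subseteq> B"
    using xs ys by auto
  ultimately show False
    using B xs(1) ys(1) unfolding kl_sum_free_iff by (metis length_map)
qed

text \<open>This is Bezout's identity. It is applied to \<open>s\<close> for the upper bound and to
  \<open>k - l\<close> when an interval is placed.\<close>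

lemma gcd_dvd_imp_cong_multiple:
  fixes s n :: nat and z :: int
  assumes "0 < n" "int (gcd s n) dvd z"
  obtains c :: nat where "[int c * int s = z] (mod int n)"
proof -
  obtain q where q: "z = int (gcd s n) * q" using assms(2) by (auto elim: dvdE)
  obtain u v where uv: "u * int s + v * int n = int (gcd s n)"
    using bezout_int[of "int s" "int n"] by auto
  define c where "c = nat ((u * q) mod int n)"
  have "[int c * int s = (u * q) * int s] (mod int n)"
    using assms(1) by (intro cong_mult) (simp_all add: c_def cong_def)
  also have "[(u * q) * int s = (u * q) * int s + (v * q) * int n] (mod int n)"
    by (simp add: cong_def)
  also have "(u * q) * int s + (v * q) * int n = z"
    using uv q by (simp add: algebra_simps flip: uv)
  finally show ?thesis using that by blast
qed

section \<open>Upper bound: from residues to periodic sets of integers\<close>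

definition lift_mod :: "nat \<Rightarrow> nat set \<Rightarrow> int set" where
  "lift_mod n A = {x. nat (x mod int n) \<in> A}"

lemma periodic_lift_mod: "periodic (int n) (lift_mod n A)"
  by (rule periodicI) (simp add: lift_mod_def cong_def)

lemma int_mem_lift_mod: "A \<subseteq> {0..<n} \<Longrightarrow> a \<in> A \<Longrightarrow> int a \<in> lift_mod n A"
  by (auto simp: lift_mod_def subset_iff)

lemma residue_count_lift_mod:
  assumes "A \<subseteq> {0..<n}"
  shows "residue_count (int n) (lift_mod n A) = card A"
proof -
  have "lift_mod n A \<inter> {0..<int n} = int ` A"
  proof (intro equalityI subsetI)
    fix x assume "x \<in> lift_mod n A \<inter> {0..<int n}"
    then have "nat x \<in> A" "x = int (nat x)" by (auto simp: lift_mod_def)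
    then show "x \<in> int ` A" by blast
  next
    fix x assume "x \<in> int ` A"
    then show "x \<in> lift_mod n A \<inter> {0..<int n}"
      using assms by (auto simp: lift_mod_def subset_iff)
  qed
  then show ?thesis by (simp add: residue_count_def card_image)
qed

lemma lift_mod_memE:
  assumes "0 < n" "x \<in> lift_mod n A"
  obtains a where "a \<in> A" "[x = int a] (mod int n)"
  using assms by (intro that[of "nat (x mod int n)"]) (auto simp: lift_mod_def cong_def)

text \<open>Reads an element of the sumset of the sets \<open>A - a\<close> as a sum of elements of
  \<open>A\<close>, once the sum of the base points is added back. The lemma for reflections does
  the same for the sets \<open>b - A\<close>.\<close>

lemma mem_sum_list_translates:
  assumes n: "0 < n" and z: "z \<in> sum_list (map (\<lambda>a. {x. x + int a \<in> lift_mod n A}) as)"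
  shows "\<exists>xs. length xs = length as \<and> set xs \<subseteq> A \<and>
    [z + int (sum_list as) = int (sum_list xs)] (mod int n)"
  using z
proof (induction as arbitrary: z)
  case Nil
  then show ?case by simp
next
  case (Cons a as)
  then obtain p q where z: "z = p + q" and p: "p + int a \<in> lift_mod n A"
    and q: "q \<in> sum_list (map (\<lambda>a. {x. x + int a \<in> lift_mod n A}) as)"
    by (auto elim!: set_plus_elim)
  obtain x where x: "x \<in> A" "[p + int a = int x] (mod int n)" using lift_mod_memE[OF n p] .
  obtain xs where xs: "length xs = length as" "set xs \<subseteq> A"
    "[q + int (sum_list as) = int (sum_list xs)] (mod int n)" using Cons.IH[OF q] by blast
  have "[(p + int a) + (q + int (sum_list as)) = int x + int (sum_list xs)] (mod int n)"
    using x xs by (intro cong_add)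
  then show ?case using x xs z by (intro exI[of _ "x # xs"]) (simp add: algebra_simps)
qed

lemma mem_sum_list_reflections:
  assumes n: "0 < n" and z: "z \<in> sum_list (map (\<lambda>b. {x. int b - x \<in> lift_mod n A}) bs)"
  shows "\<exists>ys. length ys = length bs \<and> set ys \<subseteq> A \<and>
    [int (sum_list bs) - z = int (sum_list ys)] (mod int n)"
  using z
proof (induction bs arbitrary: z)
  case Nil
  then show ?case by simp
next
  case (Cons b bs)
  then obtain p q where z: "z = p + q" and p: "int b - p \<in> lift_mod n A"
    and q: "q \<in> sum_list (map (\<lambda>b. {x. int b - x \<in> lift_mod n A}) bs)"
    by (auto elim!: set_plus_elim)
  obtain y where y: "y \<in> A" "[int b - p = int y] (mod int n)" using lift_mod_memE[OF n p] .
  obtain ys where ys: "length ys = length bs" "set ys \<subseteq> A"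
    "[int (sum_list bs) - q = int (sum_list ys)] (mod int n)" using Cons.IH[OF q] by blast
  have "[(int b - p) + (int (sum_list bs) - q) = int y + int (sum_list ys)] (mod int n)"
    using y ys by (intro cong_add)
  then show ?case using y ys z by (intro exI[of _ "y # ys"]) (simp add: algebra_simps)
qed

lemma C_kl_sum_free_dichotomy:
  assumes n: "1 \<le> n" and kl: "1 \<le> k" "1 \<le> l"
    and free: "C_kl_sum_free n {0, s mod n} k l A"
  shows "(k + l) * card A \<le> n \<or> kl_sum_free (gcd s n) k l ((\<lambda>x. x mod gcd s n) ` A)"
proof (rule disjCI)
  let ?d = "gcd s n" and ?Z = "lift_mod n A"
  have n': "0 < n" "0 < int n" using n by auto
  have d: "0 < ?d" using n by simp
  have A: "A \<subseteq> {0..<n}" using free by (simp add: C_kl_sum_free_def)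
  assume "\<not> kl_sum_free ?d k l ((\<lambda>x. x mod ?d) ` A)"
  moreover have "(\<lambda>x. x mod ?d) ` A \<subseteq> {0..<?d}" using d by auto
  ultimately obtain xs' ys' where xs': "length xs' = k" "set xs' \<subseteq> (\<lambda>x. x mod ?d) ` A"
    and ys': "length ys' = l" "set ys' \<subseteq> (\<lambda>x. x mod ?d) ` A"
    and eq': "[sum_list xs' = sum_list ys'] (mod ?d)"
    unfolding kl_sum_free_iff by blast
  have unmap: "\<exists>as. set as \<subseteq> A \<and> zs = map (\<lambda>x. x mod ?d) as"
    if "set zs \<subseteq> (\<lambda>x. x mod ?d) ` A" for zs
  proof -
    have "zs \<in> lists ((\<lambda>x. x mod ?d) ` A)" using that by auto
    then show ?thesis unfolding lists_image by auto
  qed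
  obtain as where as: "set as \<subseteq> A" "xs' = map (\<lambda>x. x mod ?d) as" using unmap[OF xs'(2)] by blast
  obtain bs where bs: "set bs \<subseteq> A" "ys' = map (\<lambda>x. x mod ?d) bs" using unmap[OF ys'(2)] by blast
  have len: "length as = k" "length bs = l" using xs'(1) ys'(1) as bs by auto
  have "[sum_list as = sum_list bs] (mod ?d)"
    using eq' unfolding as(2) bs(2) using cong_sum_list_map_mod by (metis cong_sym cong_trans)
  then have "int ?d dvd int (sum_list as) - int (sum_list bs)"
    by (simp only: cong_int_iff flip: cong_iff_dvd_diff)
  moreover have "int ?d dvd int s" by (simp only: of_nat_dvd_iff gcd_dvd1)
  ultimately have "int ?d dvd (int l - 1) * int s - (int (sum_list as) - int (sum_list bs))"
    by (intro dvd_diff[OF dvd_mult])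
  \<comment> \<open>With this \<open>c\<close>, a representation of \<open>int c * int s\<close>
    with progression term \<open>w * s\<close> says that a sum of \<open>k\<close> elements of
    \<open>A\<close> minus a sum of \<open>l\<close> elements is \<open>(l - 1 - w) * s\<close>
    modulo \<open>n\<close>. As \<open>w\<close> runs from 0 to \<open>k + l - 2\<close>, the number
    \<open>w - (l - 1)\<close> takes exactly the values \<open>u - v\<close> with
    \<open>u < k\<close> and \<open>v < l\<close>.\<close>
  then obtain c where
    c: "[int c * int s = (int l - 1) * int s - (int (sum_list as) - int (sum_list bs))] (mod int n)"
    using gcd_dvd_imp_cong_multiple n'(1) by blast
  define F where "F = (\<lambda>a. {x. x + int a \<in> ?Z})"
  define G where "G = (\<lambda>b. {x. int b - x \<in> ?Z})"
  have F: "periodic (int n) (F a) \<and> 0 \<in> F a" "residue_count (int n) (F a) = card A" if "a \<in> A" for a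
    using that n' A by (simp_all add: F_def periodic_translate periodic_lift_mod int_mem_lift_mod
        residue_count_translate residue_count_lift_mod)
  have G: "periodic (int n) (G a) \<and> 0 \<in> G a" "residue_count (int n) (G a) = card A" if "a \<in> A" for a
    using that n' A by (simp_all add: G_def periodic_reflect periodic_lift_mod int_mem_lift_mod
        residue_count_reflect residue_count_lift_mod)
  \<comment> \<open>One of the \<open>k + l\<close> sets serves as \<open>P\<close>; the other
    \<open>k + l - 1\<close> form \<open>L\<close>, whose length matches the number of terms of the
    progression.\<close>
  obtain a as' where as_eq: "as = a # as'" using len kl by (cases as) auto
  define L where "L = map F as' @ map G bs"
  have sum_L: "F a + sum_list L = sum_list (map F as) + sum_list (map G bs)"
    by (simp add: L_def as_eq add.assoc)
  have "int c * int s \<notin> F a + sum_list L + (\<lambda>i. int i * int s) ` {..<length L}"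
  proof
    assume "int c * int s \<in> F a + sum_list L + (\<lambda>i. int i * int s) ` {..<length L}"
    then obtain z1 z2 w where eq: "int c * int s = z1 + z2 + int w * int s"
      and z: "z1 \<in> sum_list (map F as)" "z2 \<in> sum_list (map G bs)" and "w < length L"
      unfolding sum_L by (auto elim!: set_plus_elim)
    then have w: "w < k + l - 1" using len by (auto simp: L_def as_eq)
    obtain xs where xs: "length xs = k" "set xs \<subseteq> A"
      and xs_cong: "[z1 + int (sum_list as) = int (sum_list xs)] (mod int n)"
      using mem_sum_list_translates[OF n'(1)] z(1) len unfolding F_def by blast
    obtain ys where ys: "length ys = l" "set ys \<subseteq> A"
      and ys_cong: "[int (sum_list bs) - z2 = int (sum_list ys)] (mod int n)"
      using mem_sum_list_reflections[OF n'(1)] z(2) len unfolding G_def by blast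
    \<comment> \<open>Truncated subtraction makes \<open>u\<close> and \<open>v\<close> the positive
      and negative parts of \<open>w - (l - 1)\<close>.\<close>
    define u v where "u = w - (l - 1)" and "v = (l - 1) - w"
    have uv: "u < k" "v < l" using w kl by (auto simp: u_def v_def)
    have uv_diff: "int u - int v = int w - (int l - 1)" using kl by (simp add: u_def v_def of_nat_diff)
    have "[int (sum_list xs) - int (sum_list ys)
        = (z1 + int (sum_list as)) - (int (sum_list bs) - z2)] (mod int n)"
      using xs_cong ys_cong by (intro cong_diff) (auto intro: cong_sym)
    also have "(z1 + int (sum_list as)) - (int (sum_list bs) - z2)
        = int c * int s - int w * int s + (int (sum_list as) - int (sum_list bs))"
      using eq by simp
    also have "[\<dots> = (int l - 1) * int s - (int (sum_list as) - int (sum_list bs)) - int w * int s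
        + (int (sum_list as) - int (sum_list bs))] (mod int n)"
      using c by (intro cong_add cong_diff) auto
    also have "(int l - 1) * int s - (int (sum_list as) - int (sum_list bs)) - int w * int s
        + (int (sum_list as) - int (sum_list bs)) = - ((int u - int v) * int s)"
      unfolding uv_diff by (simp add: algebra_simps)
    finally have "[int (sum_list xs) - int (sum_list ys) = int v * int s - int u * int s] (mod int n)"
      by (simp add: algebra_simps)
    then have "[int (sum_list xs + u * s) = int (sum_list ys + v * s)] (mod int n)"
      by (simp add: cong_iff_dvd_diff algebra_simps)
    then have "[sum_list xs + u * s = sum_list ys + v * s] (mod n)" by (simp only: cong_int_iff)
    then show False using free xs ys uv unfolding C_kl_sum_free_iff[OF kl] by blast
  qed
  moreover have "\<forall>X\<in>set L. periodic (int n) X \<and> 0 \<in> X"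
    using as(1) bs(1) F(1) G(1) by (auto simp: L_def as_eq)
  moreover have "a \<in> A" using as(1) as_eq by simp
  ultimately have bound:
    "residue_count (int n) (F a) + (\<Sum>X\<leftarrow>L. residue_count (int n) X) \<le> nat (int n)"
    using F(1) n'(2) by (intro sumset_progression_bound) auto
  have FG: "map (residue_count (int n) \<circ> F) as = map (\<lambda>_. card A) as"
       "map (residue_count (int n) \<circ> G) bs = map (\<lambda>_. card A) bs"
    using F(2) G(2) as(1) bs(1) by auto
  have "residue_count (int n) (F a) + (\<Sum>X\<leftarrow>L. residue_count (int n) X)
      = sum_list (map (residue_count (int n) \<circ> F) as) + sum_list (map (residue_count (int n) \<circ> G) bs)"
    by (simp add: L_def as_eq)
  also have "\<dots> = (k + l) * card A"
    unfolding FG by (simp add: sum_list_triv len algebra_simps)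
  finally show "(k + l) * card A \<le> n" using bound by simp
qed

section \<open>Lower bound: intervals\<close>

lemma sum_list_interval_cong:
  fixes a t m :: int
  assumes "\<And>x. x \<in> set xs \<Longrightarrow> \<exists>i. 0 \<le> i \<and> i \<le> t \<and> [int x = a + i] (mod m)"
  shows "\<exists>I. 0 \<le> I \<and> I \<le> int (length xs) * t \<and> [int (sum_list xs) = int (length xs) * a + I] (mod m)"
  using assms
proof (induction xs)
  case Nil
  then show ?case by (intro exI[of _ 0]) simp
next
  case (Cons x xs)
  obtain i where i: "0 \<le> i" "i \<le> t" "[int x = a + i] (mod m)" using Cons.prems by auto
  obtain I where I: "0 \<le> I" "I \<le> int (length xs) * t"
    "[int (sum_list xs) = int (length xs) * a + I] (mod m)" using Cons by auto
  have "[int x + int (sum_list xs) = (a + i) + (int (length xs) * a + I)] (mod m)"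
    using i I by (intro cong_add)
  then show ?case using i I by (intro exI[of _ "i + I"]) (simp add: algebra_simps)
qed

text \<open>By the divisibility there is \<open>a\<close> with \<open>(k - l) * a\<close> congruent
  to \<open>x\<close>. For the residues of \<open>a, ..., a + t - 1\<close>, every difference of the
  two kinds of sums is congruent to some \<open>D\<close> between
  \<open>x - l * (t - 1) - (l - 1) * s\<close> and \<open>x + k * (t - 1) + (k - 1) * s\<close>. The
  hypotheses place this range strictly between 0 and \<open>n\<close>, so \<open>D\<close> is never
  a multiple of \<open>n\<close>.\<close>

lemma C_kl_sum_free_interval:
  fixes x :: int
  assumes kl: "l < k" "1 \<le> l" and t: "1 \<le> t" "t \<le> n"
    and x: "int (gcd n (k - l)) dvd x"
      "int l * (int t - 1) + (int l - 1) * int s < x"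
      "x + int k * (int t - 1) + (int k - 1) * int s < int n"
  obtains A where "C_kl_sum_free n {0, s mod n} k l A" "card A = t"
proof -
  have n: "0 < n" using t by simp
  obtain c where c: "[int c * int (k - l) = x] (mod int n)"
    using gcd_dvd_imp_cong_multiple[OF n, of "k - l" x] x(1) by (auto simp: gcd.commute)
  define a where "a = int c"
  define f where "f = (\<lambda>i. nat ((a + int i) mod int n))"
  define A where "A = f ` {..<t}"
  have f: "int (f i) = (a + int i) mod int n" for i using n by (simp add: f_def)
  have "inj_on f {..<t}"
  proof (rule inj_onI)
    fix i j assume ij: "i \<in> {..<t}" "j \<in> {..<t}" "f i = f j"
    then have "[a + int i = a + int j] (mod int n)" using f by (metis cong_def)
    then have "[i = j] (mod n)" by (simp add: cong_add_lcancel cong_int_iff)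
    then show "i = j" using ij t(2) by (simp add: cong_def)
  qed
  then have card: "card A = t" by (simp add: A_def card_image)
  have A: "\<exists>i. 0 \<le> i \<and> i \<le> int t - 1 \<and> [int y = a + i] (mod int n)" if "y \<in> A" for y
  proof -
    obtain i where "i < t" "y = f i" using \<open>y \<in> A\<close> by (auto simp: A_def)
    then show ?thesis using f by (intro exI[of _ "int i"]) (auto simp: cong_def)
  qed
  have kl': "1 \<le> k" using kl by simp
  have "C_kl_sum_free n {0, s mod n} k l A"
    unfolding C_kl_sum_free_iff[OF kl' kl(2)]
  proof (intro conjI allI impI notI)
    show "A \<subseteq> {0..<n}" using n by (auto simp: A_def f_def nat_less_iff)
    fix xs ys u v
    assume xs: "length xs = k" "set xs \<subseteq> A" and ys: "length ys = l" "set ys \<subseteq> A"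
      and uv: "u < k" "v < l" and eq: "[sum_list xs + u * s = sum_list ys + v * s] (mod n)"
    obtain I where I: "0 \<le> I" "I \<le> int k * (int t - 1)"
      "[int (sum_list xs) = int k * a + I] (mod int n)"
      using sum_list_interval_cong[of xs "int t - 1" a "int n"] A xs by blast
    obtain J where J: "0 \<le> J" "J \<le> int l * (int t - 1)"
      "[int (sum_list ys) = int l * a + J] (mod int n)"
      using sum_list_interval_cong[of ys "int t - 1" a "int n"] A ys by blast
    define D where "D = x + I + int u * int s - J - int v * int s"
    have us: "0 \<le> int u * int s" "int u * int s \<le> (int k - 1) * int s"
      and vs: "0 \<le> int v * int s" "int v * int s \<le> (int l - 1) * int s"
      using uv by (auto intro!: mult_right_mono)
    have D: "0 < D" "D < int n"
      using I J us vs x unfolding D_def by linarith+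
    have ka: "int c * int (k - l) = int k * a - int l * a"
      using kl by (simp add: a_def of_nat_diff algebra_simps)
    have "[int k * a + I + int u * int s = int (sum_list xs) + int u * int s] (mod int n)"
      using I(3) by (intro cong_add) (auto intro: cong_sym)
    also have "[int (sum_list xs) + int u * int s = int (sum_list ys) + int v * int s] (mod int n)"
      using eq by (metis cong_int_iff of_nat_add of_nat_mult)
    also have "[int (sum_list ys) + int v * int s = int l * a + J + int v * int s] (mod int n)"
      using J(3) by (intro cong_add) auto
    finally have "int n dvd (int k * a + I + int u * int s) - (int l * a + J + int v * int s)"
      by (simp only: cong_iff_dvd_diff)
    moreover have "int n dvd int k * a - int l * a - x"
      using c unfolding ka by (simp only: cong_iff_dvd_diff)
    ultimately have "int n dvd (int k * a + I + int u * int s) - (int l * a + J + int v * int s)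
        - (int k * a - int l * a - x)" by (rule dvd_diff)
    then have "int n dvd D" by (simp add: D_def algebra_simps)
    then show False using D zdvd_not_zless by blast
  qed
  then show ?thesis using that card by blast
qed

theorem theorem2:
  fixes n k l s :: nat
  assumes "n \<ge> 1" and "k > l" and "l \<ge> 1" and "s \<ge> 1"
  defines "C \<equiv> {0, s mod n}"
      and "r \<equiv> (- int k * ((int n + 2 * (int s - 1)) div (int k + int l)) + (int s - 1)) mod int (gcd n (k - l))"
      and "M \<equiv> Max {mu e k l * (n div e) | e. e dvd gcd s n}"
  shows "int (muC n C k l) \<ge> max (int M) ((int n + 2 * (int s - 1) - r) div (int k + int l) - (int s - 1))
       \<and> muC n C k l \<le> max M (n div (k + l))"
proof -
  have kl: "1 \<le> k" "1 \<le> l" using assms by auto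
  have d: "0 < gcd s n" using assms(1) by simp
  let ?S = "{mu e k l * (n div e) | e. e dvd gcd s n}"
  have "?S = (\<lambda>e. mu e k l * (n div e)) ` {e. e dvd gcd s n}" by auto
  then have fin: "finite ?S" using finite_divisors_nat[OF d] by (metis finite_imageI)

  have "M \<in> ?S" unfolding M_def using fin by (intro Max_in) auto
  then obtain e where e: "e dvd gcd s n" and M: "M = mu e k l * (n div e)" by auto
  have e': "e dvd s" "e dvd n" "0 < e" using e d by (auto intro: Nat.gr0I)
  obtain B where B: "kl_sum_free e k l B" "card B = mu e k l" using mu_attained[OF kl(1)] .
  have "B \<subseteq> {0..<e}" using B(1) by (simp add: kl_sum_free_def)
  from card_residue_preimage[OF e'(3,2) this]
  have "card {x \<in> {0..<n}. x mod e \<in> B} = M" by (simp only: M B(2))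
  then have lower1: "M \<le> muC n C k l"
    using card_le_muC[OF C_kl_sum_free_residue_preimage[OF kl e'(2,1) B(1)]] by (simp add: C_def)

  define N m where "N = int n + 2 * (int s - 1)" and "m = (N - r) div (int k + int l)"
  define \<delta> where "\<delta> = int (gcd n (k - l))"
  have lower2: "m - (int s - 1) \<le> int (muC n C k l)"
  proof (cases "m - (int s - 1) \<le> 0")
    case True
    then show ?thesis by linarith
  next
    case False
    define t where "t = nat (m - (int s - 1))"
    have t: "int t = m - (int s - 1)" "1 \<le> t" using False by (auto simp: t_def)
    have \<delta>: "0 < \<delta>" "\<delta> \<le> int k - int l" "\<delta> dvd int n"
    proof -
      show "0 < \<delta>" using assms by (simp add: \<delta>_def)
      have "gcd n (k - l) \<le> k - l" using assms by (intro gcd_le2_nat) simp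
      then show "\<delta> \<le> int k - int l" using assms(2) by (simp add: \<delta>_def del: gcd_le2_nat)
      show "\<delta> dvd int n" unfolding \<delta>_def by (simp only: of_nat_dvd_iff gcd_dvd1)
    qed
    have r: "r = (- int k * (N div (int k + int l)) + (int s - 1)) mod \<delta>"
      by (simp add: r_def N_def \<delta>_def)
    then have "0 \<le> r" using \<delta>(1) by simp
    have kl_pos: "0 < int k + int l" using kl by simp
    have m_le: "(int k + int l) * m \<le> N - r"
      using mult_div_mod_eq[of "int k + int l" "N - r"] pos_mod_sign[OF kl_pos, of "N - r"]
      unfolding m_def by linarith
    \<comment> \<open>For \<open>t = m - (s - 1)\<close> the two inequalities on \<open>x\<close>
      say that it lies between \<open>l * m - (s - 1)\<close> and \<open>top\<close>, a window whose
      ends differ by \<open>N - (k + l) * m\<close>. Rounding \<open>top\<close> down to a multiple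
      of \<delta> stays in the window exactly when \<open>gap\<close> holds.\<close>
    define top where "top = int n - int k * m + (int s - 1)"
    have gap: "top mod \<delta> \<le> N - (int k + int l) * m"
    proof (cases "m = N div (int k + int l)")
      case True
      have "top = (- int k * m + (int s - 1)) + int n" by (simp add: top_def)
      then have "top mod \<delta> = r" using \<delta>(3) r True
        by (simp add: dvd_imp_mod_0 flip: mod_add_right_eq)
      then show ?thesis using m_le by simp
    \<comment> \<open>Here subtracting \<open>r\<close> has lowered the quotient, which leaves a
      slack of at least \<open>k + l\<close>, more than any remainder modulo \<delta>.\<close>
    next
      case False
      have "m \<le> N div (int k + int l)"
        unfolding m_def using \<open>0 \<le> r\<close> kl_pos by (intro zdiv_mono1) auto
      with False have "(int k + int l) * (m + 1) \<le> (int k + int l) * (N div (int k + int l))"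
        using kl_pos by (intro mult_left_mono) auto
      also have "\<dots> \<le> N" using kl_pos pos_mod_sign[of "int k + int l" N]
        mult_div_mod_eq[of "int k + int l" N] by linarith
      finally have "int k + int l \<le> N - (int k + int l) * m" by (simp add: algebra_simps)
      moreover have "top mod \<delta> < \<delta>" using \<delta>(1) by simp
      ultimately show ?thesis using \<delta>(2) kl by linarith
    qed
    define x where "x = top - top mod \<delta>"
    have "\<delta> dvd x" by (simp add: x_def minus_mod_eq_mult_div)
    then have x1: "int (gcd n (k - l)) dvd x" by (simp only: \<delta>_def)
    have x2: "int l * (int t - 1) + (int l - 1) * int s < x"
      using gap by (simp add: t(1) x_def top_def N_def algebra_simps)
    have "0 \<le> top mod \<delta>" using \<delta>(1) by simp
    then have x3: "x + int k * (int t - 1) + (int k - 1) * int s < int n"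
      by (simp add: t(1) x_def top_def algebra_simps)
    \<comment> \<open>The interval must not wrap around onto itself. As \<open>k + l\<close> is at
      least 3, \<open>3 * m\<close> is at most \<open>n + 2 * (s - 1)\<close>, whence
      \<open>3 * t\<close> is at most \<open>n - (s - 1)\<close>.\<close>
    have "3 * m \<le> (int k + int l) * m"
      using assms t by (intro mult_right_mono) linarith+
    then have "3 * m \<le> N" using m_le \<open>0 \<le> r\<close> by linarith
    then have "int t \<le> int n" using t(1) assms(4) unfolding N_def by presburger
    then have "t \<le> n" by simp
    obtain A where "C_kl_sum_free n {0, s mod n} k l A" "card A = t"
      using C_kl_sum_free_interval[OF assms(2,3) t(2) \<open>t \<le> n\<close> x1 x2 x3] .
    then have "t \<le> muC n C k l" using card_le_muC C_def by metis
    then show ?thesis using t(1) by linarith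
  qed

  obtain A where A: "C_kl_sum_free n {0, s mod n} k l A" "card A = muC n C k l"
    using muC_attained[OF kl] C_def by metis
  have upper: "muC n C k l \<le> max M (n div (k + l))"
    using C_kl_sum_free_dichotomy[OF assms(1) kl A(1)]
  proof
    assume "(k + l) * card A \<le> n"
    then have "card A \<le> n div (k + l)"
      using kl by (simp add: less_eq_div_iff_mult_less_eq mult.commute)
    then show ?thesis using A(2) by simp
  next
    \<comment> \<open>\<open>A\<close> lies in the preimage of its own image modulo
      \<open>gcd s n\<close>, so the divisor \<open>gcd s n\<close> itself provides the bound by
      \<open>M\<close>.\<close>
    let ?B = "(\<lambda>x. x mod gcd s n) ` A"
    assume B: "kl_sum_free (gcd s n) k l ?B"
    have "A \<subseteq> {0..<n}" using A(1) by (simp add: C_kl_sum_free_def)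
    then have "card A \<le> card {x \<in> {0..<n}. x mod gcd s n \<in> ?B}" by (intro card_mono) auto
    also have "\<dots> = card ?B * (n div gcd s n)"
      using d B by (intro card_residue_preimage) (auto simp: kl_sum_free_def)
    also have "\<dots> \<le> mu (gcd s n) k l * (n div gcd s n)"
      using card_le_mu[OF B] by (rule mult_le_mono1)
    also have "\<dots> \<le> M" unfolding M_def using fin by (intro Max_ge) auto
    finally show ?thesis using A(2) by simp
  qed
  show ?thesis using lower1 lower2 upper by (simp add: m_def N_def)
qed

end
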